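(* Let $\{P_n(z)\}$ be a polynomial sequence whose generating function is $$\sum_{n=0}^{\infty}P_n(z)t^n=\frac{1}{1+B(z)t^3+A(z)t^4},$$ where $B(z)$ and $A(z)$ are polynomials in $z$ with complex coefficients. For all $n$, the zeros $z$ of $P_n(z)$ which satisfy $A(z)B(z)\neq 0$ lie on the real algebraic curve defined by $$\Im\left(\frac{B^4(z)}{A^3(z)}\right)=0\qquad\text{and}\qquad 0\le \Re\left(\frac{B^4(z)}{A^3(z)}\right)<\infty .$$
   Context: The generating function identity is an identity of power series in $t$ whose coefficients are polynomials in the complex variable $z$. $\Re$ and $\Im$ denote real and imaginary parts, $B^4(z)=(B(z))^4$ and $A^3(z)=(A(z))^3$.
   Formalization: "For all n" is taken as all n other than 1, 2, 5; for these three P_n is identically zero whatever A and B are, so every z would be a zero and the claim fails (e.g. n=1, A=1, B=z, z=1+i gives B^4/A^3=-4). *)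

theory Defs
  imports
    Complex_Main
    "HOL-Computational_Algebra.Polynomial"
    "HOL-Computational_Algebra.Formal_Power_Series"
begin

text \<open>
  The generating function identity is stated in the power series ring
  \<open>complex poly fps\<close>. The type \<open>complex poly\<close> has no \<open>inverse\<close>, so \<open>F = 1 / D\<close> is written
  \<open>F * D = 1\<close>; this determines \<open>F\<close>, the inverse of the unit \<open>D\<close> of a commutative ring.

  The indices 1, 2 and 5 are those not of the form \<open>3 * i + 4 * j\<close>. For them \<open>P n\<close> is the zero
  polynomial whatever \<open>A\<close> and \<open>B\<close> are, so that every \<open>z\<close> would count as a zero.
\<close>

end

theory Submission
  imports Defs
begin

text \<open>
  Fix \<open>z\<close> with \<open>A(z) B(z) \<noteq> 0\<close>, put \<open>a = -A(z)\<close>, \<open>b = -B(z)\<close>, and suppose that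
  \<open>x = b^4 / a^3\<close> is not a nonpositive real; by complex conjugation let \<open>Im x \<ge> 0\<close>. With a
  suitable fourth root \<open>s\<close> of \<open>a\<close>, the numbers \<open>q n = P n (z) / s^n\<close> satisfy
  \<open>q (n + 4) = q n + y q (n + 1)\<close>, where \<open>y^4 = x\<close> and \<open>y\<close> has argument \<open>\<phi> \<in> [0, \<pi>/4)\<close>.
  If \<open>\<theta> n\<close> denotes the argument of \<open>q n\<close>, the chain
  \<open>\<theta> n \<le> \<theta> (n + 1) + \<phi> \<le> \<theta> (n + 2) + 2 \<phi> \<le> \<theta> (n + 3) + 3 \<phi> \<le> \<theta> n + 4 \<phi>\<close>
  is preserved by the recurrence: the summands \<open>q n\<close> and \<open>y q (n + 1)\<close> have arguments differing
  by at most \<open>4 \<phi> < \<pi>\<close>, so their sum is nonzero and its argument lies between theirs. The chain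
  holds at \<open>n = 6\<close>, hence no \<open>q n\<close> with \<open>n \<ge> 6\<close> vanishes.
\<close>

text \<open>The angle is any real, not a representative modulo \<open>2 * pi\<close>, so
  inequalities between angles pass along a recurrence without the jumps of
  \<open>Arg\<close>.\<close>

definition has_argument :: "complex \<Rightarrow> real \<Rightarrow> bool"
  where "has_argument w \<alpha> \<longleftrightarrow> (\<exists>r>0. w = of_real r * cis \<alpha>)"

lemma has_argument_nonzero: "has_argument w \<alpha> \<Longrightarrow> w \<noteq> 0"
  by (auto simp: has_argument_def)

lemma has_argument_mult:
  assumes "has_argument v \<alpha>" "has_argument w \<beta>"
  shows "has_argument (v * w) (\<alpha> + \<beta>)"
proof -
  obtain r s where rs: "r > 0" "v = of_real r * cis \<alpha>" "s > 0" "w = of_real s * cis \<beta>"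
    using assms by (auto simp: has_argument_def)
  have "v * w = of_real (r * s) * cis (\<alpha> + \<beta>)"
    by (simp add: rs cis_mult[symmetric])
  with rs show ?thesis
    unfolding has_argument_def by (meson mult_pos_pos)
qed

lemma has_argument_of_real: "r > 0 \<Longrightarrow> has_argument (of_real r) 0"
  by (auto simp: has_argument_def)

lemma has_argument_Arg: "w \<noteq> 0 \<Longrightarrow> has_argument w (Arg w)"
  unfolding has_argument_def
  by (rule exI[of _ "cmod w"]) (metis rcis_cmod_Arg rcis_def zero_less_norm_iff)

text \<open>For distinct angles, rotating \<open>v\<close> onto the positive axis puts the sum in
  the open upper half-plane, and rotating \<open>w\<close> there instead puts it in the lower one. A
  gap below \<open>pi\<close> gives both signs, which trap the argument of the sum.\<close>

lemma has_argument_add: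
  assumes "has_argument v \<alpha>" "has_argument w \<beta>" "\<alpha> \<le> \<beta>" "\<beta> < \<alpha> + pi"
  shows "\<exists>\<gamma>. has_argument (v + w) \<gamma> \<and> \<alpha> \<le> \<gamma> \<and> \<gamma> \<le> \<beta>"
proof -
  obtain r s where r: "r > 0" "v = of_real r * cis \<alpha>" and s: "s > 0" "w = of_real s * cis \<beta>"
    using assms by (auto simp: has_argument_def)
  define \<delta> where "\<delta> = \<beta> - \<alpha>"
  show ?thesis
  proof (cases "\<delta> = 0")
    case True
    then have "v + w = of_real (r + s) * cis \<alpha>"
      by (simp add: r s \<delta>_def algebra_simps)
    then have "has_argument (v + w) \<alpha>"
      unfolding has_argument_def using r s by (intro exI[of _ "r + s"]) auto
    with assms show ?thesis by blast
  next
    case False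
    with assms have \<delta>: "0 < \<delta>" "\<delta> < pi" by (auto simp: \<delta>_def)
    define u where "u = of_real r + of_real s * cis \<delta>"
    have vw: "v + w = cis \<alpha> * u"
      by (simp add: u_def r s \<delta>_def algebra_simps cis_mult)
    have sin\<delta>: "sin \<delta> > 0" using \<delta> by (rule sin_gt_zero)
    have "Im u > 0" using s sin\<delta> by (simp add: u_def)
    then have "u \<noteq> 0" by auto
    then have u_arg: "has_argument u (Arg u)" by (rule has_argument_Arg)
    then obtain t where t: "t > 0" "u = of_real t * cis (Arg u)"
      by (auto simp: has_argument_def)
    have "t * sin (Arg u) > 0"
      using \<open>Im u > 0\<close> arg_cong[OF t(2), of Im] by simp
    then have "sin (Arg u) > 0" using t by (simp add: zero_less_mult_iff)
    then have pos: "Arg u > 0"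
      using Arg_bounded[of u] sin_ge_zero[of "- Arg u"] by (cases "Arg u > 0") auto
    \<comment> \<open>Second rotation: the summand from \<open>w\<close> becomes real, so the sign
      of the imaginary part comes from \<open>r\<close> alone.\<close>
    have "u * cis (- \<delta>) = of_real t * cis (Arg u - \<delta>)"
      by (subst t(2)) (simp add: mult.assoc cis_mult)
    moreover have "u * cis (- \<delta>) = of_real r * cis (- \<delta>) + of_real s"
      by (simp add: u_def algebra_simps cis_mult)
    ultimately have "Im (of_real t * cis (Arg u - \<delta>)) = Im (of_real r * cis (- \<delta>) + of_real s)"
      by simp
    then have "t * sin (Arg u - \<delta>) = - (r * sin \<delta>)" by simp
    then have "t * sin (Arg u - \<delta>) < 0"
      using r(1) sin\<delta> by simp
    then have "sin (Arg u - \<delta>) < 0"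
      using t(1) by (simp add: mult_less_0_iff)
    then have le: "Arg u \<le> \<delta>"
      using Arg_bounded[of u] \<delta> sin_ge_zero[of "Arg u - \<delta>"] by (cases "Arg u \<le> \<delta>") auto
    have "has_argument (cis \<alpha>) \<alpha>"
      unfolding has_argument_def by (intro exI[of _ 1]) auto
    then have "has_argument (v + w) (\<alpha> + Arg u)"
      unfolding vw using u_arg by (rule has_argument_mult)
    with pos le show ?thesis
      by (intro exI[of _ "\<alpha> + Arg u"]) (auto simp: \<delta>_def)
  qed
qed

lemma sector_recurrence_nonzero:
  fixes q :: "nat \<Rightarrow> complex"
  assumes rec: "\<And>n. q (n + 4) = q n + y * q (n + 1)"
    and y: "has_argument y \<phi>" and \<phi>: "0 \<le> \<phi>" "\<phi> < pi / 4"
    and init: "has_argument (q 0) \<alpha>" "has_argument (q 1) \<beta>"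
      "has_argument (q 2) \<gamma>" "has_argument (q 3) \<delta>"
    and chain: "\<alpha> \<le> \<beta> + \<phi>" "\<beta> \<le> \<gamma> + \<phi>" "\<gamma> \<le> \<delta> + \<phi>" "\<delta> \<le> \<alpha> + \<phi>"
  shows "q n \<noteq> 0"
proof -
  have "\<exists>\<alpha> \<beta> \<gamma> \<delta>. has_argument (q n) \<alpha> \<and> has_argument (q (n + 1)) \<beta>
      \<and> has_argument (q (n + 2)) \<gamma> \<and> has_argument (q (n + 3)) \<delta>
      \<and> \<alpha> \<le> \<beta> + \<phi> \<and> \<beta> \<le> \<gamma> + \<phi> \<and> \<gamma> \<le> \<delta> + \<phi> \<and> \<delta> \<le> \<alpha> + \<phi>"
  proof (induction n)
    case 0
    show ?case
      by (rule exI[of _ \<alpha>], rule exI[of _ \<beta>], rule exI[of _ \<gamma>], rule exI[of _ \<delta>])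
        (use init chain in \<open>simp add: eval_nat_numeral\<close>)
  next
    case (Suc n)
    then obtain \<alpha> \<beta> \<gamma> \<delta> where arg: "has_argument (q n) \<alpha>" "has_argument (q (n + 1)) \<beta>"
      "has_argument (q (n + 2)) \<gamma>" "has_argument (q (n + 3)) \<delta>"
      and le: "\<alpha> \<le> \<beta> + \<phi>" "\<beta> \<le> \<gamma> + \<phi>" "\<gamma> \<le> \<delta> + \<phi>" "\<delta> \<le> \<alpha> + \<phi>"
      by blast
    have "\<exists>\<epsilon>. has_argument (q n + y * q (n + 1)) \<epsilon> \<and> \<alpha> \<le> \<epsilon> \<and> \<epsilon> \<le> \<phi> + \<beta>"
      using le \<phi> by (intro has_argument_add arg has_argument_mult[OF y]) auto
    then obtain \<epsilon> where \<epsilon>: "has_argument (q (n + 4)) \<epsilon>" "\<alpha> \<le> \<epsilon>" "\<epsilon> \<le> \<beta> + \<phi>"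
      by (auto simp: rec add.commute)
    \<comment> \<open>The window moves on by one. Its only new links are \<epsilon> \<le> \<beta> +
      \<phi>, already known, and \<delta> \<le> \<epsilon> + \<phi>, which follows from \<delta>
      \<le> \<alpha> + \<phi> and \<alpha> \<le> \<epsilon>.\<close>
    show ?case
      by (rule exI[of _ \<beta>], rule exI[of _ \<gamma>], rule exI[of _ \<delta>], rule exI[of _ \<epsilon>])
        (use arg \<epsilon> le in \<open>simp add: eval_nat_numeral\<close>)
  qed
  then show ?thesis using has_argument_nonzero by blast
qed

text \<open>Excluding 0 and the negative axis makes the upper bound strict, so a quarter of the
  argument stays below \<open>pi / 4\<close>.\<close>

lemma Arg_upper_half_plane:
  assumes "Im x \<ge> 0" "Im x = 0 \<Longrightarrow> Re x > 0"
  shows "0 \<le> Arg x" "Arg x < pi"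
proof -
  from assms have "x \<noteq> 0" by auto
  then obtain r where r: "r > 0" "x = of_real r * cis (Arg x)"
    using has_argument_Arg by (auto simp: has_argument_def)
  have Im: "Im x = r * sin (Arg x)" and Re: "Re x = r * cos (Arg x)"
    by (subst r(2), simp)+
  have "sin (Arg x) \<ge> 0"
    using assms(1) r(1) by (simp add: Im zero_le_mult_iff)
  then show "0 \<le> Arg x"
    using Arg_bounded[of x] sin_gt_zero[of "- Arg x"] by (cases "Arg x \<ge> 0") auto
  have "Arg x \<noteq> pi"
    using assms(2) r(1) Im Re by auto
  then show "Arg x < pi"
    using Arg_bounded[of x] by auto
qed

lemma trinomial_recurrence_nonzero_upper:
  fixes p :: "nat \<Rightarrow> complex" and a b :: complex
  assumes init: "p 0 = 1" "p 1 = 0" "p 2 = 0" "p 3 = b"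
    and rec: "\<And>n. p (n + 4) = b * p (n + 1) + a * p n"
    and ab: "a \<noteq> 0" "b \<noteq> 0"
    and half_plane: "Im (b ^ 4 / a ^ 3) \<ge> 0" "Im (b ^ 4 / a ^ 3) = 0 \<Longrightarrow> Re (b ^ 4 / a ^ 3) > 0"
    and n: "n \<notin> {1, 2, 5}"
  shows "p n \<noteq> 0"
proof -
  define x where "x = b ^ 4 / a ^ 3"
  define \<phi> where "\<phi> = Arg x / 4"
  define y where "y = of_real (root 4 (cmod x)) * cis \<phi>"
  \<comment> \<open>The normalisation needs both \<open>s ^ 4 = a\<close> and
    \<open>s ^ 3 * y = b\<close>; dividing them forces this choice among the fourth roots of
    \<open>a\<close>.\<close>
  define s where "s = a * y / b"
  define q where "q = (\<lambda>n. p n / s ^ n)"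
  have x0: "x \<noteq> 0" using ab by (simp add: x_def)
  have \<phi>: "0 \<le> \<phi>" "\<phi> < pi / 4"
    using Arg_upper_half_plane[of x] half_plane by (auto simp: \<phi>_def x_def)
  have y_arg: "has_argument y \<phi>"
    using x0 by (auto simp: has_argument_def y_def)
  then have y0: "y \<noteq> 0" by (rule has_argument_nonzero)
  have "y ^ 4 = of_real (root 4 (cmod x) ^ 4) * cis (Arg x)"
    unfolding y_def power_mult_distrib Complex.DeMoivre of_real_power by (simp add: \<phi>_def)
  also have "\<dots> = x"
    using rcis_cmod_Arg[of x] by (simp add: real_root_pow_pos2 rcis_def)
  finally have y4: "y ^ 4 = b ^ 4 / a ^ 3" by (simp add: x_def)
  have s0: "s \<noteq> 0" using ab y0 by (simp add: s_def)
  have "s ^ 4 = a ^ 4 * (b ^ 4 / a ^ 3) / b ^ 4"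
    unfolding y4[symmetric] by (simp add: s_def power_divide power_mult_distrib)
  also have "\<dots> = a"
    using ab by (simp add: eval_nat_numeral)
  finally have s4: "s ^ 4 = a" .
  have "s ^ 3 * y * s = s ^ 4 * y"
    by (simp add: eval_nat_numeral)
  also have "\<dots> = b * s"
    unfolding s4 using ab by (simp add: s_def)
  finally have "s ^ 3 * y * s = b * s" .
  then have b: "b = s ^ 3 * y" using s0 by simp
  have q_rec: "q (n + 4) = q n + y * q (n + 1)" for n
  proof -
    have "p (n + 4) = s ^ 3 * y * p (n + 1) + s ^ 4 * p n"
      using rec b s4 by simp
    then show ?thesis
      using s0 by (simp add: q_def field_simps power_add eval_nat_numeral)
  qed
  have q_init: "q 0 = 1" "q 1 = 0" "q 2 = 0" "q 3 = y"
    using s0 init by (simp_all add: q_def) (simp add: b)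
  have q4: "q 4 = 1" using q_rec[of 0] q_init by simp
  have q5: "q 5 = 0" using q_rec[of 1] q_init by (simp add: eval_nat_numeral)
  have q6: "q 6 = y * y" using q_rec[of 2] q_init by simp
  have q7: "q 7 = 2 * y" using q_rec[of 3] q_init q4 by simp
  have q8: "q 8 = 1" using q_rec[of 4] q4 q5 by simp
  have q9: "q 9 = y * (y * y)" using q_rec[of 5] q5 q6 by simp
  have "q n \<noteq> 0"
  proof (cases "n < 6")
    case True
    with n have "n = 0 \<or> n = 3 \<or> n = 4" by auto
    then show ?thesis using q_init q4 y0 by auto
  next
    \<comment> \<open>As \<open>q 5 = 0\<close>, the first usable window is 6 to 9, with values
      \<open>y ^ 2\<close>, \<open>2 * y\<close>, \<open>1\<close>, \<open>y ^ 3\<close>; their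
      arguments 2 \<phi>, \<phi>, 0, 3 \<phi> satisfy the chain.\<close>
    case False
    have "q ((n - 6) + 6) \<noteq> 0"
    proof (rule sector_recurrence_nonzero[where q = "\<lambda>k. q (k + 6)" and y = y and \<phi> = \<phi>
          and \<alpha> = "\<phi> + \<phi>" and \<beta> = "0 + \<phi>" and \<gamma> = 0 and \<delta> = "\<phi> + (\<phi> + \<phi>)"])
      show "q (k + 4 + 6) = q (k + 6) + y * q (k + 1 + 6)" for k
        using q_rec[of "k + 6"] by (simp add: add.commute add.left_commute)
      show "has_argument (q (0 + 6)) (\<phi> + \<phi>)"
        using has_argument_mult[OF y_arg y_arg] by (simp add: q6)
      show "has_argument (q (1 + 6)) (0 + \<phi>)"
        using has_argument_mult[OF has_argument_of_real[of 2] y_arg] by (simp add: q7)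
      show "has_argument (q (2 + 6)) 0"
        using has_argument_of_real[of 1] by (simp add: q8)
      show "has_argument (q (3 + 6)) (\<phi> + (\<phi> + \<phi>))"
        using has_argument_mult[OF y_arg has_argument_mult[OF y_arg y_arg]] by (simp add: q9)
    qed (use y_arg \<phi> in auto)
    with False show ?thesis by simp
  qed
  then show ?thesis by (auto simp: q_def)
qed

text \<open>If the quotient lies in the lower half-plane, the conjugate sequence has coefficients
  \<open>cnj a\<close>, \<open>cnj b\<close> and a quotient in the upper one.\<close>

lemma trinomial_recurrence_nonzero:
  fixes p :: "nat \<Rightarrow> complex" and a b :: complex
  assumes init: "p 0 = 1" "p 1 = 0" "p 2 = 0" "p 3 = b"
    and rec: "\<And>n. p (n + 4) = b * p (n + 1) + a * p n"
    and ab: "a \<noteq> 0" "b \<noteq> 0"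
    and slit_plane: "Im (b ^ 4 / a ^ 3) = 0 \<Longrightarrow> Re (b ^ 4 / a ^ 3) > 0"
    and n: "n \<notin> {1, 2, 5}"
  shows "p n \<noteq> 0"
proof (cases "Im (b ^ 4 / a ^ 3) \<ge> 0")
  case True
  with assms show ?thesis by (intro trinomial_recurrence_nonzero_upper[of p b a n])
next
  case False
  have cnj: "cnj b ^ 4 / cnj a ^ 3 = cnj (b ^ 4 / a ^ 3)" by simp
  have "cnj (p n) \<noteq> 0"
  proof (rule trinomial_recurrence_nonzero_upper[of "\<lambda>k. cnj (p k)" "cnj b" "cnj a"])
    show "Im (cnj b ^ 4 / cnj a ^ 3) \<ge> 0"
      unfolding cnj cnj.sel using False by linarith
    show "Re (cnj b ^ 4 / cnj a ^ 3) > 0" if "Im (cnj b ^ 4 / cnj a ^ 3) = 0"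
      using that False unfolding cnj cnj.sel by linarith
    show "cnj (p (k + 4)) = cnj b * cnj (p (k + 1)) + cnj a * cnj (p k)" for k
      unfolding rec by simp
  qed (use init ab n in simp_all)
  then show ?thesis by simp
qed

theorem theorem10:
  fixes A B :: "complex poly" and P :: "nat \<Rightarrow> complex poly" and n :: nat and z :: complex
  assumes generating_function:
    "Abs_fps P * (1 + fps_const B * fps_X ^ 3 + fps_const A * fps_X ^ 4) = 1"
  assumes index: "n \<notin> {1, 2, 5}"
  assumes zero: "poly (P n) z = 0"
  assumes nonzero: "poly A z * poly B z \<noteq> 0"
  shows "Im (poly B z ^ 4 / poly A z ^ 3) = 0 \<and> Re (poly B z ^ 4 / poly A z ^ 3) \<in> {0..}"
proof -
  \<comment> \<open>Comparison of the coefficients of \<open>t^k\<close>; the case splits guard the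
    truncated subtractions.\<close>
  have coeff: "P k + (if k < 3 then 0 else P (k - 3) * B) + (if k < 4 then 0 else P (k - 4) * A)
      = (if k = 0 then 1 else 0)" for k
    using arg_cong[OF generating_function, of "\<lambda>F. fps_nth F k"]
    by (simp add: distrib_left mult.assoc[symmetric] fps_X_power_mult_right_nth
        fps_mult_right_const_nth split: if_splits)
  have P_init: "P 0 = 1" "P 1 = 0" "P 2 = 0" and P3: "P 3 = - B"
    using coeff[of 0] coeff[of 1] coeff[of 2] coeff[of 3] by (simp_all add: add_eq_0_iff)
  have P_rec: "P (k + 4) = - (P (k + 1) * B) - P k * A" for k
    using coeff[of "k + 4"] by (simp add: eq_diff_eq eq_neg_iff_add_eq_0 ac_simps)
  have rec: "poly (P (k + 4)) z
      = (- poly B z) * poly (P (k + 1)) z + (- poly A z) * poly (P k) z" for k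
    unfolding P_rec by (simp add: mult.commute)
  define w where "w = poly B z ^ 4 / poly A z ^ 3"
  \<comment> \<open>Negating both coefficients flips the sign, since 4 is even and 3 odd: the
    excluded nonpositive reals become the half-line of the claim.\<close>
  have w: "(- poly B z) ^ 4 / (- poly A z) ^ 3 = - w"
    by (simp add: w_def)
  have "\<not> (Im (- w) = 0 \<longrightarrow> Re (- w) > 0)"
    using trinomial_recurrence_nonzero[of "\<lambda>k. poly (P k) z" "- poly B z" "- poly A z" n]
      P_init P3 rec nonzero index zero w by auto
  then show ?thesis by (auto simp: w_def)
qed

end
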